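(* Let $T$ be an almost weakly stable contraction on a Hilbert space $H$. Then $T$ is almost weakly polynomial stable, i.e., for every $h\in H$ and every non-constant polynomial $p\in\mathcal{P}$, the sequence $\{T^{p(j)}h\}_{j=1}^\infty$ is almost weakly stable.
   Context: $\mathbb{N}^+$ denotes the positive integers and $\mathbb{N}_0$ the nonnegative integers. $\mathcal{P}\subset\mathbb{Z}[X]$ is the set of all polynomials with integer coefficients mapping $\mathbb{N}^+$ into $\mathbb{N}_0$. A contraction is a bounded linear operator of norm at most $1$. The density of a strictly increasing sequence $\{n_k\}_{k\in\mathbb{N}^+}\subset\mathbb{N}^+$ is $\lim_{n\to\infty}\frac{1}{n}\left|\{k\in\mathbb{N}^+ : n_k\le n\}\right|$ whenever this limit exists. A sequence $\{x_n\}_{n\in\mathbb{N}^+}$ in a Banach space $X$ is called almost weakly stable if there exists a strictly increasing sequence $\{n_k\}_{k\in\mathbb{N}^+}\subset\mathbb{N}^+$ of density $1$ such that $x_{n_k}\to 0$ weakly as $k\to\infty$. A bounded operator $T$ on $X$ is called almost weakly stable if for every $x\in X$ the orbit $\{T^nx\}_{n\in\mathbb{N}^+}$ is an almost weakly stable sequence. *)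

theory Defs
  imports "HOL-Analysis.Analysis" "HOL-Computational_Algebra.Polynomial"
begin

text \<open>
  Real Hilbert spaces are the types of sort \<open>{real_inner, complete_space}\<close>. The following class
  adds a complex structure, so that complex Hilbert spaces are the types of sort
  \<open>{complex_inner, complete_space}\<close>. The underlying real inner product is the real part of the
  complex one, whence \<open>norm x = sqrt (Re (cinner x x))\<close>, and positive definiteness is inherited from
  \<^class>\<open>real_inner\<close>. The complex inner product is linear in its first argument.
\<close>

class complex_inner = real_inner +
  fixes scaleC :: "complex \<Rightarrow> 'a \<Rightarrow> 'a"  (infixr \<open>*\<^sub>C\<close> 75)
    and cinner :: "'a \<Rightarrow> 'a \<Rightarrow> complex"
  assumes scaleC_add_right: "a *\<^sub>C (x + y) = a *\<^sub>C x + a *\<^sub>C y"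
    and scaleC_add_left: "(a + b) *\<^sub>C x = a *\<^sub>C x + b *\<^sub>C x"
    and scaleC_scaleC: "a *\<^sub>C b *\<^sub>C x = (a * b) *\<^sub>C x"
    and scaleC_of_real: "complex_of_real r *\<^sub>C x = r *\<^sub>R x"
    and cinner_commute: "cinner x y = cnj (cinner y x)"
    and cinner_add_left: "cinner (x + y) z = cinner x z + cinner y z"
    and cinner_scaleC_left: "cinner (a *\<^sub>C x) y = a * cinner x y"
    and inner_eq_Re_cinner: "inner x y = Re (cinner x y)"

lemma vector_space_scaleC: "vector_space (scaleC :: complex \<Rightarrow> 'a::complex_inner \<Rightarrow> 'a)"
proof
  show "1 *\<^sub>C x = x" for x :: 'a
    using scaleC_of_real[of 1 x] by simp
qed (simp_all add: scaleC_add_right scaleC_add_left scaleC_scaleC)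

lemma norm_eq_sqrt_cinner: "norm (x :: 'a::complex_inner) = sqrt (Re (cinner x x))"
  by (simp add: norm_eq_sqrt_inner inner_eq_Re_cinner)

instantiation complex :: complex_inner
begin

definition scaleC_complex :: "complex \<Rightarrow> complex \<Rightarrow> complex"
  where "scaleC_complex a x = a * x"

definition cinner_complex :: "complex \<Rightarrow> complex \<Rightarrow> complex"
  where "cinner_complex x y = x * cnj y"

instance
  by standard
    (auto simp: scaleC_complex_def cinner_complex_def inner_complex_def algebra_simps scaleR_conv_of_real)

end

text \<open>
  The notions below are relative to a scalar multiplication \<open>s\<close>, which is \<^term>\<open>scaleR\<close> for a real
  and \<^term>\<open>scaleC\<close> for a complex space. As \<^const>\<open>bounded_linear\<close> only speaks about real
  linearity, linearity with respect to \<open>s\<close> is required separately.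
\<close>

definition bounded_functional ::
    "('k::real_normed_field \<Rightarrow> 'a::real_normed_vector \<Rightarrow> 'a) \<Rightarrow> ('a \<Rightarrow> 'k) \<Rightarrow> bool" where
  "bounded_functional s \<phi> \<longleftrightarrow> Vector_Spaces.linear s (*) \<phi> \<and> bounded_linear \<phi>"

definition bounded_operator ::
    "('k::real_normed_field \<Rightarrow> 'a::real_normed_vector \<Rightarrow> 'a) \<Rightarrow> ('a \<Rightarrow> 'a) \<Rightarrow> bool" where
  "bounded_operator s T \<longleftrightarrow> Vector_Spaces.linear s s T \<and> bounded_linear T"

definition contraction ::
    "('k::real_normed_field \<Rightarrow> 'a::real_normed_vector \<Rightarrow> 'a) \<Rightarrow> ('a \<Rightarrow> 'a) \<Rightarrow> bool" where
  "contraction s T \<longleftrightarrow> bounded_operator s T \<and> onorm T \<le> 1"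

definition weakly_tendsto ::
    "('k::real_normed_field \<Rightarrow> 'a::real_normed_vector \<Rightarrow> 'a) \<Rightarrow> (nat \<Rightarrow> 'a) \<Rightarrow> 'a \<Rightarrow> bool" where
  "weakly_tendsto s x l \<longleftrightarrow> (\<forall>\<phi>. bounded_functional s \<phi> \<longrightarrow> (\<lambda>k. \<phi> (x k)) \<longlonglongrightarrow> \<phi> l)"

text \<open>
  Index sequences are enumerated from \<open>k = 0\<close> rather than from \<open>k = 1\<close>; their values are positive.
  Correspondingly, a sequence indexed by the positive integers is a function on \<^typ>\<open>nat\<close> whose
  value at \<open>0\<close> is never used.
\<close>

definition has_density :: "(nat \<Rightarrow> nat) \<Rightarrow> real \<Rightarrow> bool" where
  "has_density r d \<longleftrightarrow> (\<lambda>n. real (card {k. r k \<le> n}) / real n) \<longlonglongrightarrow> d"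

definition almost_weakly_stable_seq ::
    "('k::real_normed_field \<Rightarrow> 'a::real_normed_vector \<Rightarrow> 'a) \<Rightarrow> (nat \<Rightarrow> 'a) \<Rightarrow> bool" where
  "almost_weakly_stable_seq s x \<longleftrightarrow>
    (\<exists>r. strict_mono r \<and> (\<forall>k. 0 < r k) \<and> has_density r 1 \<and> weakly_tendsto s (\<lambda>k. x (r k)) 0)"

definition almost_weakly_stable ::
    "('k::real_normed_field \<Rightarrow> 'a::real_normed_vector \<Rightarrow> 'a) \<Rightarrow> ('a \<Rightarrow> 'a) \<Rightarrow> bool" where
  "almost_weakly_stable s T \<longleftrightarrow>
    bounded_operator s T \<and> (\<forall>x. almost_weakly_stable_seq s (\<lambda>n. (T ^^ n) x))"

definition nonneg_int_polys :: "int poly set" where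
  "nonneg_int_polys = {p. \<forall>n::nat. 0 < n \<longrightarrow> 0 \<le> poly p (int n)}"

definition almost_weakly_polynomial_stable ::
    "('k::real_normed_field \<Rightarrow> 'a::real_normed_vector \<Rightarrow> 'a) \<Rightarrow> ('a \<Rightarrow> 'a) \<Rightarrow> bool" where
  "almost_weakly_polynomial_stable s T \<longleftrightarrow>
    (\<forall>h. \<forall>p \<in> nonneg_int_polys. 0 < degree p \<longrightarrow>
      almost_weakly_stable_seq s (\<lambda>j. (T ^^ nat (poly p (int j))) h))"

end

theory Submission imports Defs begin

text \<open>
  For a bounded sequence \<open>u\<close> and a functional \<open>\<phi>\<close> write \<open>c j = \<phi> (u j)\<close>. On a window of \<open>D\<close>
  consecutive indices the sum of the \<open>(c j)\<^sup>2\<close> is \<open>\<phi> (\<Sum>j. c j *\<^sub>R u j)\<close>, so its square is bounded by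
  the correlations within the window. Hence the averages of \<open>(c j)\<^sup>2\<close> vanish as soon as
  the averages of \<open>\<bar>u (j + k) \<bullet> u j\<bar>\<close> do for every \<open>k > 0\<close>.

  For \<open>u j = T\<^bsup>p(j)\<^esup> h\<close> and \<open>q(j) = p(j + k) - p(j)\<close> the correlation is
  \<open>T\<^bsup>m\<^esup> (T\<^bsup>q(j)\<^esup> h) \<bullet> T\<^bsup>m\<^esup> h\<close> with \<open>m = p(j)\<close>. As \<open>T\<close> is a contraction, \<open>m\<close> may be replaced by a
  fixed large \<open>M\<close> up to a uniformly small error, which leaves a fixed functional evaluated along
  the orbit for the polynomial \<open>q\<close> of smaller degree. Induction on the degree reduces everything to
  linear polynomials, where the hypothesis on \<open>T\<close> applies because arithmetic progressions have
  positive density.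

  To get a single density-one sequence of indices for all functionals it suffices to control the
  countably many functionals \<open>x \<mapsto> x \<bullet> u i\<close>: almost orthogonality of the members of \<open>u\<close> to one
  another forces weak convergence to zero.
\<close>

section \<open>Vanishing averages\<close>

text \<open>For bounded nonnegative \<open>f\<close> this is equivalent to convergence to zero along
  a density-one set of indices. The averaged form is easier to add, dominate and reindex, so
  stability is translated into it and only translated back at the end.\<close>

definition cesaro_null :: "(nat \<Rightarrow> real) \<Rightarrow> bool" where
  "cesaro_null f \<longleftrightarrow> (\<lambda>N. (\<Sum>n<N. f n) / real N) \<longlonglongrightarrow> 0"

lemma cesaro_null_zero [simp]: "cesaro_null (\<lambda>_. 0)"
  by (simp add: cesaro_null_def)

lemma cesaro_null_add:
  assumes "cesaro_null f" "cesaro_null g"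
  shows "cesaro_null (\<lambda>n. f n + g n)"
  using tendsto_add[OF assms[unfolded cesaro_null_def]]
  by (simp add: cesaro_null_def sum.distrib add_divide_distrib)

lemma cesaro_null_cmult:
  assumes "cesaro_null f"
  shows "cesaro_null (\<lambda>n. c * f n)"
  using tendsto_mult_right[OF assms[unfolded cesaro_null_def], of c]
  by (simp add: cesaro_null_def mult.commute flip: sum_distrib_left)

lemma cesaro_null_sum:
  assumes "\<And>i. i \<in> I \<Longrightarrow> cesaro_null (f i)"
  shows "cesaro_null (\<lambda>n. \<Sum>i\<in>I. f i n)"
  using assms by (induction I rule: infinite_finite_induct) (auto intro: cesaro_null_add)

lemma cesaro_null_mono:
  assumes "cesaro_null g" "\<And>n. 0 \<le> f n" "\<And>n. f n \<le> g n"
  shows "cesaro_null f"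
  unfolding cesaro_null_def
proof (rule tendsto_sandwich[OF _ _ tendsto_const assms(1)[unfolded cesaro_null_def]])
  show "\<forall>\<^sub>F N in sequentially. 0 \<le> (\<Sum>n<N. f n) / real N"
    using assms(2) by (simp add: sum_nonneg)
  show "\<forall>\<^sub>F N in sequentially. (\<Sum>n<N. f n) / real N \<le> (\<Sum>n<N. g n) / real N"
    using assms(3) by (simp add: divide_right_mono sum_mono)
qed

lemma cesaro_null_of_bounded_sums:
  assumes "\<And>N. \<bar>\<Sum>n<N. f n\<bar> \<le> C"
  shows "cesaro_null f"
  unfolding cesaro_null_def
proof (rule tendsto_rabs_zero_cancel, rule tendsto_sandwich[OF _ _ tendsto_const])
  show "\<forall>\<^sub>F N in sequentially. 0 \<le> \<bar>(\<Sum>n<N. f n) / real N\<bar>" by simp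
  show "\<forall>\<^sub>F N in sequentially. \<bar>(\<Sum>n<N. f n) / real N\<bar> \<le> C / real N"
    using assms by (simp add: divide_right_mono)
  show "(\<lambda>N. C / real N) \<longlonglongrightarrow> 0"
    by (rule lim_const_over_n)
qed

text \<open>The finitely many exceptional indices contribute a bounded amount to every partial sum,
  and all others raise the average of \<open>g\<close> by at most \<open>e\<close>. This lets the
  null majorant \<open>g\<close> depend on \<open>e\<close>.\<close>

lemma cesaro_null_approx:
  assumes nonneg: "\<And>n. 0 \<le> f n"
    and approx: "\<And>e. 0 < e \<Longrightarrow> \<exists>g. cesaro_null g \<and> (\<forall>\<^sub>F n in sequentially. f n \<le> g n + e)"
  shows "cesaro_null f"
  unfolding cesaro_null_def
proof (rule LIMSEQ_I)
  fix e :: real assume e: "0 < e"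
  then obtain g N0 where g: "cesaro_null g" and N0: "\<And>n. n \<ge> N0 \<Longrightarrow> f n \<le> g n + e / 2"
    using approx[of "e / 2"] by (auto simp: eventually_sequentially)
  \<comment> \<open>\<open>h\<close> repairs the bound on the initial segment where
    \<open>f n \<le> g n + e / 2\<close> may fail.\<close>
  define h where "h n = (if n < N0 then \<bar>f n - g n\<bar> else 0)" for n
  have "\<bar>\<Sum>n<N. h n\<bar> \<le> (\<Sum>n<N0. h n)" for N
  proof -
    have "(\<Sum>n<N. h n) = (\<Sum>n\<in>{..<N} \<inter> {..<N0}. h n)"
      by (rule sum.mono_neutral_right) (auto simp: h_def)
    also have "\<dots> \<le> (\<Sum>n<N0. h n)"
      by (rule sum_mono2) (auto simp: h_def)
    finally show ?thesis
      by (simp add: h_def sum_nonneg)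
  qed
  then have "cesaro_null h"
    by (rule cesaro_null_of_bounded_sums)
  with g have "cesaro_null (\<lambda>n. g n + h n)"
    by (rule cesaro_null_add)
  then obtain N1 where N1: "\<And>N. N \<ge> N1 \<Longrightarrow> \<bar>(\<Sum>n<N. g n + h n) / real N\<bar> < e / 2"
    using LIMSEQ_D[of "\<lambda>N. (\<Sum>n<N. g n + h n) / real N" 0 "e / 2"] e
    unfolding cesaro_null_def by auto
  have "norm ((\<Sum>n<N. f n) / real N - 0) < e" if N: "N \<ge> Suc N1" for N
  proof -
    have "(\<Sum>n<N. f n) \<le> (\<Sum>n<N. (g n + h n) + e / 2)"
    proof (rule sum_mono)
      fix n show "f n \<le> (g n + h n) + e / 2"
        using N0[of n] e by (cases "n < N0") (auto simp: h_def)
    qed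
    also have "\<dots> = (\<Sum>n<N. g n + h n) + real N * (e / 2)"
      by (simp add: sum.distrib)
    finally have "(\<Sum>n<N. f n) / real N \<le> ((\<Sum>n<N. g n + h n) + real N * (e / 2)) / real N"
      by (rule divide_right_mono) simp
    also have "\<dots> = (\<Sum>n<N. g n + h n) / real N + e / 2"
      using N by (simp add: add_divide_distrib)
    also have "\<dots> < e"
      using N1[of N] N by linarith
    finally show ?thesis
      using nonneg by (simp add: sum_nonneg)
  qed
  then show "\<exists>no. \<forall>N\<ge>no. norm ((\<Sum>n<N. f n) / real N - 0) < e" by blast
qed

text \<open>Pointwise, \<open>\<bar>f n\<bar>\<close> is at most \<open>e\<close> or at most
  \<open>(f n)\<^sup>2 / e\<close>, hence below the sum of both.\<close>

lemma cesaro_null_of_square: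
  assumes "cesaro_null (\<lambda>n. (f n)\<^sup>2)"
  shows "cesaro_null (\<lambda>n. \<bar>f n\<bar>)"
proof (rule cesaro_null_approx)
  fix e :: real assume e: "0 < e"
  have "\<bar>f n\<bar> \<le> inverse e * (f n)\<^sup>2 + e" for n
  proof -
    have "0 \<le> (\<bar>f n\<bar> - e)\<^sup>2 + \<bar>f n\<bar> * e" using e by simp
    then have "\<bar>f n\<bar> * e \<le> (f n)\<^sup>2 + e\<^sup>2"
      by (simp add: power2_eq_square algebra_simps)
    then show ?thesis
      using e by (simp add: field_simps power2_eq_square)
  qed
  then show "\<exists>g. cesaro_null g \<and> (\<forall>\<^sub>F n in sequentially. \<bar>f n\<bar> \<le> g n + e)"
    using cesaro_null_cmult[OF assms, of "inverse e"] by (intro exI[of _ "\<lambda>n. inverse e * (f n)\<^sup>2"]) simp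
qed simp

text \<open>Beyond \<open>s\<close> the values \<open>f (g n)\<close> are distinct terms of
  \<open>f\<close> with index at most \<open>a * n + b\<close>, so a partial sum of length
  \<open>N\<close> is dominated by one whose length is linear in \<open>N\<close>. This covers
  shifts and arithmetic progressions.\<close>

lemma cesaro_null_reindex:
  fixes g :: "nat \<Rightarrow> nat"
  assumes f: "cesaro_null f" "\<And>n. 0 \<le> f n"
    and g: "inj_on g {s..}" "\<And>n. n \<ge> s \<Longrightarrow> g n \<le> a * n + b"
  shows "cesaro_null (\<lambda>n. f (g n))"
proof -
  define B where "B = (\<Sum>n<s. f (g n))"
  have bound: "(\<Sum>n<N. f (g n)) \<le> B + (\<Sum>n<Suc (a * N + b). f n)" for N
  proof -
    have "(\<Sum>n<N. f (g n)) \<le> (\<Sum>n\<in>{..<s} \<union> {s..<N}. f (g n))"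
      by (rule sum_mono2) (auto simp: f)
    also have "\<dots> = B + (\<Sum>n\<in>{s..<N}. f (g n))"
      unfolding B_def by (rule sum.union_disjoint) auto
    also have "(\<Sum>n\<in>{s..<N}. f (g n)) = sum f (g ` {s..<N})"
      by (simp add: sum.reindex[OF inj_on_subset[OF g(1)]] subset_iff)
    also have "\<dots> \<le> (\<Sum>n<Suc (a * N + b). f n)"
    proof (rule sum_mono2)
      have "g n < Suc (a * N + b)" if "s \<le> n" "n < N" for n
        using g(2)[of n] that mult_le_mono2[of n N a] by linarith
      then show "g ` {s..<N} \<subseteq> {..<Suc (a * N + b)}" by auto
    qed (auto simp: f)
    finally show ?thesis by simp
  qed
  \<comment> \<open>The extra \<open>N\<close> makes the cut-off tend to infinity also for
    \<open>a = 0\<close>.\<close>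
  have sub: "filterlim (\<lambda>N. Suc (a * N + b + N)) sequentially sequentially"
    by (rule filterlim_at_top_mono[OF filterlim_ident]) auto
  have lim1: "(\<lambda>N. (\<Sum>n<Suc (a * N + b + N). f n) / real (Suc (a * N + b + N))) \<longlonglongrightarrow> 0"
    using filterlim_compose[OF f(1)[unfolded cesaro_null_def] sub] .
  have "(\<lambda>N. B / real N + (\<Sum>n<Suc (a * N + b + N). f n) / real (Suc (a * N + b + N)) *
      (real a + 1 + (real b + 1) / real N)) \<longlonglongrightarrow> 0 + 0 * (real a + 1 + 0)"
    by (intro tendsto_intros lim1 lim_const_over_n)
  then have lim: "(\<lambda>N. B / real N + (\<Sum>n<Suc (a * N + b + N). f n) / real (Suc (a * N + b + N)) *
      (real a + 1 + (real b + 1) / real N)) \<longlonglongrightarrow> 0"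
    by simp
  show ?thesis
    unfolding cesaro_null_def
  proof (rule tendsto_sandwich[OF _ _ tendsto_const lim])
    show "\<forall>\<^sub>F N in sequentially. 0 \<le> (\<Sum>n<N. f (g n)) / real N"
      by (simp add: f sum_nonneg)
    show "\<forall>\<^sub>F N in sequentially. (\<Sum>n<N. f (g n)) / real N \<le> B / real N +
        (\<Sum>n<Suc (a * N + b + N). f n) / real (Suc (a * N + b + N)) *
        (real a + 1 + (real b + 1) / real N)"
      using eventually_gt_at_top[of 0]
    proof eventually_elim
      case (elim N)
      let ?S = "\<Sum>n<Suc (a * N + b + N). f n"
      have "(\<Sum>n<Suc (a * N + b). f n) \<le> ?S"
        by (rule sum_mono2) (auto simp: f)
      with bound[of N] have "(\<Sum>n<N. f (g n)) \<le> B + ?S" by linarith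
      then have "(\<Sum>n<N. f (g n)) / real N \<le> (B + ?S) / real N"
        by (simp add: divide_right_mono)
      also have "\<dots> = B / real N + ?S / real (Suc (a * N + b + N)) * (real (Suc (a * N + b + N)) / real N)"
        by (simp add: add_divide_distrib del: of_nat_Suc sum.lessThan_Suc)
      also have "real (Suc (a * N + b + N)) / real N = real a + 1 + (real b + 1) / real N"
        using elim by (simp add: field_simps)
      finally show ?case .
    qed
  qed
qed

text \<open>A shift by one telescopes to two boundary terms; a shift by \<open>d\<close> is composed
  of \<open>d\<close> such steps.\<close>

lemma cesaro_null_diff_shift:
  assumes "\<And>n. \<bar>f n\<bar> \<le> C"
  shows "cesaro_null (\<lambda>n. f n - f (n + d))"
proof (induction d)
  case (Suc d)
  have "cesaro_null (\<lambda>n. f (n + d) - f (Suc n + d))"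
  proof (rule cesaro_null_of_bounded_sums)
    fix N
    have "(\<Sum>n<N. f (n + d) - f (Suc n + d)) = f d - f (N + d)"
      using sum_lessThan_telescope'[of "\<lambda>n. f (n + d)" N] by simp
    then show "\<bar>\<Sum>n<N. f (n + d) - f (Suc n + d)\<bar> \<le> 2 * C"
      using assms[of d] assms[of "N + d"] by linarith
  qed
  from cesaro_null_add[OF Suc.IH this] show ?case by simp
qed simp

section \<open>Density one\<close>

text \<open>The density counts indices up to and including \<open>n\<close>, whereas the average
  stops before \<open>N\<close>; hence \<open>N = Suc n\<close>, and the quotients
  \<open>n / Suc n\<close> mediate between the two normalisations.\<close>

lemma has_density_one_iff:
  assumes "strict_mono r"
  shows "has_density r 1 \<longleftrightarrow> cesaro_null (indicator (- range r))"
proof -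
  have count: "(\<Sum>m<Suc n. indicator (- range r) m) = real (Suc n) - real (card {k. r k \<le> n})" for n
  proof -
    have inj: "inj r" using assms by (rule strict_mono_imp_inj_on)
    have "(\<Sum>m<Suc n. indicator (- range r) m :: real) = (\<Sum>m<Suc n. 1 - indicator (range r) m)"
      by (intro sum.cong) (auto simp: indicator_def)
    also have "\<dots> = real (Suc n) - (\<Sum>m<Suc n. indicator (range r) m)"
      by (simp add: sum_subtractf)
    also have "(\<Sum>m<Suc n. indicator (range r) m :: real) = real (card ({..<Suc n} \<inter> range r))"
      by (simp add: indicator_def sum.If_cases del: sum.lessThan_Suc)
    also have "{..<Suc n} \<inter> range r = r ` {k. r k \<le> n}" by auto
    also have "card (r ` {k. r k \<le> n}) = card {k. r k \<le> n}"
      by (rule card_image) (rule inj_on_subset[OF inj subset_UNIV])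
    finally show ?thesis .
  qed
  let ?c = "\<lambda>n. real (card {k. r k \<le> n})"
  let ?g = "\<lambda>n. (\<Sum>m<Suc n. indicator (- range r) m) / real (Suc n)"
  have iff: "cesaro_null (indicator (- range r)) \<longleftrightarrow> ?g \<longlonglongrightarrow> 0"
    unfolding cesaro_null_def by (rule filterlim_sequentially_Suc[symmetric])
  have g: "?g n = 1 - ?c n / real (Suc n)" for n
    unfolding count by (simp add: diff_divide_distrib del: of_nat_Suc)
  have g': "\<forall>\<^sub>F n in sequentially. ?g n = 1 - ?c n / real n * (real n / real (Suc n))"
    using eventually_gt_at_top[of 0] by eventually_elim (simp add: g del: of_nat_Suc sum.lessThan_Suc)
  have c: "\<forall>\<^sub>F n in sequentially. ?c n / real n = (1 - ?g n) * (real (Suc n) / real n)"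
    using eventually_gt_at_top[of 0] by eventually_elim (simp add: g del: of_nat_Suc sum.lessThan_Suc)
  show ?thesis
  proof
    assume "has_density r 1"
    then have "(\<lambda>n. 1 - ?c n / real n * (real n / real (Suc n))) \<longlonglongrightarrow> 1 - 1 * 1"
      unfolding has_density_def by (intro tendsto_intros LIMSEQ_n_over_Suc_n)
    then have "?g \<longlonglongrightarrow> 0"
      using tendsto_cong[OF g'] by simp
    with iff show "cesaro_null (indicator (- range r))" by simp
  next
    assume "cesaro_null (indicator (- range r))"
    with iff have "?g \<longlonglongrightarrow> 0" by blast
    then have "(\<lambda>n. (1 - ?g n) * (real (Suc n) / real n)) \<longlonglongrightarrow> (1 - 0) * 1"
      by (intro tendsto_intros LIMSEQ_Suc_n_over_n)
    then show "has_density r 1"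
      unfolding has_density_def using tendsto_cong[OF c] by simp
  qed
qed

text \<open>Along the range of \<open>r\<close> the values eventually drop below \<open>e\<close>;
  off the range they are at most \<open>C\<close>, and that set has density zero.\<close>

lemma cesaro_null_of_density_one:
  assumes r: "strict_mono r" "has_density r 1" and lim: "(\<lambda>k. f (r k)) \<longlonglongrightarrow> 0"
    and f: "\<And>n. 0 \<le> f n" "\<And>n. f n \<le> C"
  shows "cesaro_null f"
proof (rule cesaro_null_approx[OF f(1)])
  fix e :: real assume "0 < e"
  then obtain K where K: "\<And>k. k \<ge> K \<Longrightarrow> f (r k) < e"
    using order_tendstoD(2)[OF lim] by (auto simp: eventually_sequentially)
  have "f n \<le> C * indicator (- range r) n + e" if "n \<ge> r K" for n
  proof (cases "n \<in> range r")
    case True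
    then obtain k where "n = r k" by auto
    with that have "k \<ge> K" using r(1) by (simp add: strict_mono_less_eq)
    with K \<open>n = r k\<close> show ?thesis by (simp add: less_imp_le)
  next
    case False
    with f(2)[of n] \<open>0 < e\<close> show ?thesis by simp
  qed
  moreover have "cesaro_null (\<lambda>n. C * indicator (- range r) n)"
    using r by (intro cesaro_null_cmult) (simp add: has_density_one_iff)
  ultimately show "\<exists>g. cesaro_null g \<and> (\<forall>\<^sub>F n in sequentially. f n \<le> g n + e)"
    by (intro exI[of _ "\<lambda>n. C * indicator (- range r) n"]) (auto simp: eventually_sequentially)
qed

text \<open>Tail suprema are decreasing with the same limit. The added \<open>1 / (n + 1)\<close>
  makes them strictly positive, which later allows cancelling \<open>sqrt (b N)\<close>.\<close>

lemma antimono_null_majorant: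
  fixes a :: "nat \<Rightarrow> real"
  assumes "a \<longlonglongrightarrow> 0"
  obtains b where "antimono b" "b \<longlonglongrightarrow> 0" "\<And>n. a n \<le> b n" "\<And>n. 0 < b n"
proof -
  have "Bseq a" using assms by (simp add: convergentI convergent_imp_Bseq)
  then obtain B where "\<And>n. \<bar>a n\<bar> \<le> B" by (auto simp: Bseq_def)
  then have bdd: "bdd_above (a ` {n..})" for n
    by (intro bdd_aboveI[of _ B]) (auto simp: abs_le_iff)
  define c where "c n = (SUP m\<in>{n..}. a m)" for n
  have ac: "a m \<le> c n" if "m \<ge> n" for m n
    unfolding c_def using that by (intro cSUP_upper bdd) auto
  have anti: "c n \<le> c m" if "m \<le> n" for m n
    unfolding c_def using that by (intro cSUP_subset_mono bdd) auto
  have lim: "c \<longlonglongrightarrow> 0"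
  proof (rule LIMSEQ_I)
    fix e :: real assume e: "0 < e"
    then obtain N where N: "\<And>n. n \<ge> N \<Longrightarrow> \<bar>a n\<bar> < e / 2"
      using LIMSEQ_D[OF assms, of "e / 2"] by auto
    have "norm (c n - 0) < e" if "n \<ge> N" for n
    proof -
      have "c n \<le> e / 2"
        unfolding c_def
      proof (rule cSUP_least)
        fix m assume "m \<in> {n..}"
        then show "a m \<le> e / 2" using N[of m] that by auto
      qed auto
      moreover have "- (e / 2) < c n" using ac[of n n] N[of n] that by linarith
      ultimately show ?thesis using e by auto
    qed
    then show "\<exists>no. \<forall>n\<ge>no. norm (c n - 0) < e" by blast
  qed
  have nonneg: "0 \<le> c n" for n
    using LIMSEQ_le_const2[OF lim, of "c n"] anti by blast
  show ?thesis
  proof (rule that[of "\<lambda>n. c n + inverse (real (Suc n))"])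
    show "antimono (\<lambda>n. c n + inverse (real (Suc n)))"
      using anti by (intro monotoneI add_mono) (auto intro: le_imp_inverse_le)
    show "(\<lambda>n. c n + inverse (real (Suc n))) \<longlonglongrightarrow> 0"
      using tendsto_add[OF lim LIMSEQ_inverse_real_of_nat] by simp
    show "a n \<le> c n + inverse (real (Suc n))" for n
      using ac[of n n] by (simp add: add_increasing2)
    show "0 < c n + inverse (real (Suc n))" for n
      using nonneg[of n] by (simp add: add_nonneg_pos)
  qed
qed

text \<open>
  The exceptional set consists of the \<open>n\<close> with \<open>f n > sqrt (b n)\<close>, where \<open>b\<close> is a decreasing null
  majorant of the averages of \<open>f\<close>: up to \<open>N\<close> it has at most \<open>N * sqrt (b N)\<close> elements.
\<close>
lemma cesaro_null_imp_density_one: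
  assumes f: "cesaro_null f" "\<And>n. 0 \<le> f n"
  obtains r where "strict_mono r" "\<And>k. 0 < r k" "has_density r 1" "(\<lambda>k. f (r k)) \<longlonglongrightarrow> 0"
proof -
  obtain b where b: "antimono b" "b \<longlonglongrightarrow> 0" "\<And>N. (\<Sum>n<N. f n) / real N \<le> b N" "\<And>n. 0 < b n"
    using antimono_null_majorant[OF f(1)[unfolded cesaro_null_def]] by metis
  have sqrt_b: "(\<lambda>n. sqrt (b n)) \<longlonglongrightarrow> 0"
    using tendsto_real_sqrt[OF b(2)] by simp
  define J where "J = {n. 0 < n \<and> f n \<le> sqrt (b n)}"
  define E where "E = {n. sqrt (b n) < f n}"
  have E: "cesaro_null (indicator E)"
    unfolding cesaro_null_def
  proof (rule tendsto_sandwich[OF _ _ tendsto_const sqrt_b])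
    show "\<forall>\<^sub>F N in sequentially. 0 \<le> (\<Sum>n<N. indicator E n :: real) / real N"
      by (simp add: sum_nonneg)
    show "\<forall>\<^sub>F N in sequentially. (\<Sum>n<N. indicator E n) / real N \<le> sqrt (b N)"
      using eventually_gt_at_top[of 0]
    proof eventually_elim
      case (elim N)
      have "(\<Sum>n<N. indicator E n) * sqrt (b N) = (\<Sum>n<N. indicator E n * sqrt (b N))"
        by (rule sum_distrib_right)
      also have "\<dots> \<le> (\<Sum>n<N. f n)"
      proof (rule sum_mono)
        fix n assume "n \<in> {..<N}"
        then have "sqrt (b N) \<le> sqrt (b n)" using antimonoD[OF b(1), of n N] by simp
        also have "sqrt (b n) \<le> f n" if "n \<in> E" using that by (simp add: E_def)
        finally show "indicator E n * sqrt (b N) \<le> f n"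
          using f(2)[of n] by (cases "n \<in> E") auto
      qed
      also have "\<dots> \<le> b N * real N"
        using b(3)[of N] elim by (simp add: field_simps)
      also have "\<dots> = (sqrt (b N) * real N) * sqrt (b N)"
        using b(4)[of N] by simp
      finally have "(\<Sum>n<N. indicator E n) \<le> sqrt (b N) * real N"
        using b(4)[of N] by (simp add: mult_le_cancel_right)
      then show ?case using elim by (simp add: field_simps)
    qed
  qed
  \<comment> \<open>\<open>J\<close> omits \<open>0\<close> to keep the indices positive, so its
    complement is \<open>E\<close> together with \<open>0\<close>.\<close>
  have "cesaro_null (indicator {0})"
    by (rule cesaro_null_of_bounded_sums[of _ 1])
       (auto simp: indicator_def intro: order_trans[OF card_mono[of "{0::nat}"]])
  from cesaro_null_add[OF E this] have J: "cesaro_null (indicator (- J))"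
    by (rule cesaro_null_mono) (auto simp: J_def E_def indicator_def)
  have "infinite J"
  proof
    assume "finite J"
    then obtain m where m: "\<And>n. n \<in> J \<Longrightarrow> n < m" by (auto simp: finite_nat_set_iff_bounded)
    have "cesaro_null (\<lambda>n. 1)"
    proof (rule cesaro_null_approx)
      have "1 \<le> indicator (- J) n + e" if "n \<ge> m" "0 < e" for n and e :: real
        using m[of n] that by (auto simp: indicator_def)
      then show "\<exists>g. cesaro_null g \<and> (\<forall>\<^sub>F n in sequentially. 1 \<le> g n + e)" if "0 < e" for e
        using J that by (intro exI[of _ "indicator (- J)"]) (auto simp: eventually_sequentially)
    qed simp
    then have "(\<lambda>N. real N / real N) \<longlonglongrightarrow> 0" by (simp add: cesaro_null_def)
    moreover have "(\<lambda>N. real N / real N) \<longlonglongrightarrow> 1"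
      by (rule tendsto_eventually) (auto intro: eventually_mono[OF eventually_gt_at_top[of "0::nat"]])
    ultimately show False using LIMSEQ_unique zero_neq_one by blast
  qed
  define r where "r = enumerate J"
  have r: "strict_mono r" "range r = J"
    using \<open>infinite J\<close> by (simp_all add: r_def strict_mono_enumerate range_enumerate)
  then have rJ: "r k \<in> J" for k by auto
  show ?thesis
  proof (rule that)
    show "strict_mono r" by fact
    show "0 < r k" for k using rJ[of k] by (simp add: J_def)
    show "has_density r 1" using r J by (simp add: has_density_one_iff)
    have "(\<lambda>k. sqrt (b (r k))) \<longlonglongrightarrow> 0"
      using LIMSEQ_subseq_LIMSEQ[OF sqrt_b r(1)] by (simp add: comp_def)
    then show "(\<lambda>k. f (r k)) \<longlonglongrightarrow> 0"
      by (rule tendsto_sandwich[OF _ _ tendsto_const, rotated 2]) (use rJ f in \<open>auto simp: J_def\<close>)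
  qed
qed

section \<open>Functionals on bounded sequences\<close>

text \<open>The sum of squares is \<open>\<phi> v\<close> for the combination \<open>v\<close> of
  the \<open>w i\<close> with coefficients \<open>\<phi> (w i)\<close>. Bounding it by
  \<open>K * norm v\<close> and expanding the squared norm leaves the inner products with
  coefficients of size at most \<open>K * M\<close>.\<close>

lemma square_sum_functional_le:
  fixes w :: "'i \<Rightarrow> 'a::real_inner" and \<phi> :: "'a \<Rightarrow> real"
  assumes \<phi>: "linear \<phi>" and K: "\<And>x. \<bar>\<phi> x\<bar> \<le> K * norm x" "0 \<le> K"
    and M: "\<And>i. norm (w i) \<le> M"
  shows "(\<Sum>i\<in>F. (\<phi> (w i))\<^sup>2)\<^sup>2 \<le> K\<^sup>2 * (K * M)\<^sup>2 * (\<Sum>i\<in>F. \<Sum>j\<in>F. \<bar>w i \<bullet> w j\<bar>)"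
proof -
  define c where "c i = \<phi> (w i)" for i
  define v where "v = (\<Sum>i\<in>F. c i *\<^sub>R w i)"
  have c: "\<bar>c i\<bar> \<le> K * M" for i
    unfolding c_def using K(1)[of "w i"] mult_left_mono[OF M K(2), of i] by linarith
  have KM: "0 \<le> K * M" using c[of undefined] by linarith
  have "(\<Sum>i\<in>F. (c i)\<^sup>2) = \<phi> v"
    by (simp add: v_def c_def linear_sum[OF \<phi>] linear_scale[OF \<phi>] power2_eq_square)
  then have "(\<Sum>i\<in>F. (c i)\<^sup>2)\<^sup>2 \<le> (K * norm v)\<^sup>2"
    using K(1)[of v] K(2) by (metis abs_le_square_iff abs_mult abs_norm_cancel abs_of_nonneg)
  also have "\<dots> = K\<^sup>2 * (\<Sum>i\<in>F. \<Sum>j\<in>F. c i * c j * (w i \<bullet> w j))"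
    by (simp add: power_mult_distrib power2_norm_eq_inner v_def inner_sum_left inner_sum_right
        sum_distrib_left mult_ac inner_commute)
  also have "\<dots> \<le> K\<^sup>2 * (\<Sum>i\<in>F. \<Sum>j\<in>F. (K * M)\<^sup>2 * \<bar>w i \<bullet> w j\<bar>)"
  proof (intro mult_left_mono sum_mono)
    fix i j
    have "\<bar>c i * c j\<bar> \<le> (K * M)\<^sup>2"
      using mult_mono[OF c[of i] c[of j] KM] by (simp add: abs_mult power2_eq_square)
    then have "\<bar>c i * c j\<bar> * \<bar>w i \<bullet> w j\<bar> \<le> (K * M)\<^sup>2 * \<bar>w i \<bullet> w j\<bar>"
      by (rule mult_right_mono) simp
    then show "c i * c j * (w i \<bullet> w j) \<le> (K * M)\<^sup>2 * \<bar>w i \<bullet> w j\<bar>"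
      using abs_ge_self[of "c i * c j * (w i \<bullet> w j)"] by (simp only: abs_mult)
  qed simp
  finally show ?thesis
    by (simp add: c_def mult.assoc flip: sum_distrib_left)
qed

text \<open>
  A form of van der Corput's inequality: the correlations enter through sliding windows of a fixed
  length \<open>D\<close>, whose diagonal contributes only a term of order \<open>1 / D\<close>.
\<close>
lemma cesaro_null_functional_of_correlations:
  fixes u :: "nat \<Rightarrow> 'a::real_inner" and \<phi> :: "'a \<Rightarrow> real"
  assumes \<phi>: "bounded_linear \<phi>" and M: "\<And>n. norm (u n) \<le> M"
    and corr: "\<And>k. 0 < k \<Longrightarrow> cesaro_null (\<lambda>n. \<bar>u (n + k) \<bullet> u n\<bar>)"
  shows "cesaro_null (\<lambda>n. (\<phi> (u n))\<^sup>2)"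
proof (rule cesaro_null_approx)
  fix e :: real assume e: "0 < e"
  obtain K where K: "\<And>x. \<bar>\<phi> x\<bar> \<le> K * norm x" "0 < K"
    using bounded_linear.pos_bounded[OF \<phi>] by (auto simp: mult.commute)
  define f where "f n = (\<phi> (u n))\<^sup>2" for n
  define A where "A = K\<^sup>2 * (K * M)\<^sup>2"
  have A: "0 \<le> A" by (simp add: A_def)
  have f_bound: "\<bar>f n\<bar> \<le> (K * M)\<^sup>2" for n
  proof -
    have "\<bar>\<phi> (u n)\<bar> \<le> K * M"
      using K(1)[of "u n"] mult_left_mono[OF M[of n], of K] K(2) by linarith
    then have "\<bar>\<phi> (u n)\<bar>\<^sup>2 \<le> (K * M)\<^sup>2" by (rule power_mono) simp
    then show ?thesis by (simp add: f_def)
  qed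
  \<comment> \<open>Within a window, the correlation of positions \<open>i\<close> and
    \<open>j\<close> is a shift of the one for the distance of \<open>i\<close> and
    \<open>j\<close>.\<close>
  have off_diag: "cesaro_null (\<lambda>n. \<bar>u (n + i) \<bullet> u (n + j)\<bar>)" if "i \<noteq> j" for i j
    using that
  proof (induction i j rule: linorder_wlog)
    case (le i j)
    then have "cesaro_null (\<lambda>n. \<bar>u (n + (j - i)) \<bullet> u n\<bar>)" by (intro corr) auto
    from cesaro_null_reindex[OF this, of "\<lambda>n. n + i" 0 1 i] le show ?case
      by (simp add: inner_commute inj_on_def add_ac)
  next
    case (sym i j)
    then show ?case by (simp add: inner_commute)
  qed
  \<comment> \<open>The diagonal finally contributes \<open>A * M\<^sup>2 / (t * D)\<close> with
    \<open>t = e / 2\<close>, and this choice makes it at most \<open>t\<close>.\<close>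
  obtain D :: nat where D: "A * M\<^sup>2 * (4 / e\<^sup>2) < real D" using reals_Archimedean2 by blast
  moreover have "0 \<le> A * M\<^sup>2 * (4 / e\<^sup>2)" using A by simp
  ultimately have D0: "0 < real D" by linarith
  define t where "t = e / 2"
  have t: "0 < t" using e by (simp add: t_def)
  define G where "G n = (\<Sum>i<D. \<Sum>j<D. if i = j then 0 else \<bar>u (n + i) \<bullet> u (n + j)\<bar>)" for n
  define B where "B = A / (t * (real D)\<^sup>2)"
  \<comment> \<open>\<open>f n\<close> is its window average plus its mean deviation from the
    window. The deviation averages out by telescoping; the window average is bounded by
    \<open>B * G n + e\<close>.\<close>
  define g where "g n = (1 / real D) * (\<Sum>i<D. f n - f (n + i)) + B * G n" for n
  have "cesaro_null (\<lambda>n. if i = j then 0 else \<bar>u (n + i) \<bullet> u (n + j)\<bar>)" for i j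
    using off_diag[of i j] by (cases "i = j") auto
  then have "cesaro_null G"
    unfolding G_def by (intro cesaro_null_sum)
  then have "cesaro_null g"
    unfolding g_def
    by (intro cesaro_null_add cesaro_null_cmult cesaro_null_sum cesaro_null_diff_shift[OF f_bound])
  moreover have "f n \<le> g n + e" for n
  proof -
    define W where "W = (\<Sum>i<D. f (n + i))"
    have "W\<^sup>2 \<le> A * (\<Sum>i<D. \<Sum>j<D. \<bar>u (n + i) \<bullet> u (n + j)\<bar>)"
      unfolding A_def W_def f_def using K
      by (intro square_sum_functional_le M bounded_linear.linear[OF \<phi>]) auto
    also have "\<dots> \<le> A * (\<Sum>i<D. \<Sum>j<D. (if i = j then 0 else \<bar>u (n + i) \<bullet> u (n + j)\<bar>) +
        (if i = j then M\<^sup>2 else 0))"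
    proof (intro mult_left_mono sum_mono A)
      fix i j
      have "u (n + i) \<bullet> u (n + i) \<le> M\<^sup>2"
        using power_mono[OF M[of "n + i"], of 2] by (simp add: power2_norm_eq_inner)
      then show "\<bar>u (n + i) \<bullet> u (n + j)\<bar> \<le> (if i = j then 0 else \<bar>u (n + i) \<bullet> u (n + j)\<bar>) +
        (if i = j then M\<^sup>2 else 0)" by auto
    qed
    also have "\<dots> = A * G n + A * M\<^sup>2 * real D"
      by (simp add: sum.distrib G_def distrib_left mult_ac)
    finally have W2: "W\<^sup>2 \<le> A * G n + A * M\<^sup>2 * real D" .
    \<comment> \<open>Only \<open>W\<^sup>2\<close> is controlled by correlations; this inequality
      makes the bound linear in \<open>W\<close> at the cost of an error \<open>t\<close>.\<close>
    have "0 \<le> (W - t * real D)\<^sup>2 + W * (t * real D)"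
      using t by (simp add: W_def f_def sum_nonneg)
    then have "W * (t * real D) \<le> W\<^sup>2 + (t * real D)\<^sup>2"
      by (simp add: power2_eq_square algebra_simps)
    then have "W / real D \<le> W\<^sup>2 / (t * (real D)\<^sup>2) + t"
      using t D0 by (simp add: field_simps power2_eq_square)
    also have "W\<^sup>2 / (t * (real D)\<^sup>2) \<le> (A * G n + A * M\<^sup>2 * real D) / (t * (real D)\<^sup>2)"
      using W2 t by (intro divide_right_mono) auto
    also have "\<dots> = B * G n + A * M\<^sup>2 / (t * real D)"
      using t D0 by (simp add: B_def field_simps power2_eq_square)
    also have "A * M\<^sup>2 / (t * real D) \<le> t"
      using D D0 e by (simp add: t_def field_simps power2_eq_square)
    finally have "W / real D \<le> B * G n + e" by (simp add: t_def)
    moreover have "f n = (1 / real D) * (\<Sum>i<D. f n - f (n + i)) + W / real D"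
      using D0 by (simp add: W_def sum_subtractf diff_divide_distrib)
    ultimately show ?thesis by (simp add: g_def)
  qed
  ultimately show "\<exists>g. cesaro_null g \<and> (\<forall>\<^sub>F n in sequentially. (\<phi> (u n))\<^sup>2 \<le> g n + e)"
    unfolding f_def by auto
qed simp

text \<open>
  Averaging the inner products with all members of the sequence, with summable weights, yields one
  density-one sequence of indices for all of them. Along it every functional \<open>\<phi>\<close> tends to zero:
  otherwise one could select arbitrarily many almost orthogonal members on which \<open>\<phi>\<close> is bounded
  away from zero.
\<close>
lemma density_one_of_cesaro_null:
  fixes u :: "nat \<Rightarrow> 'a::real_inner"
  assumes M: "\<And>n. norm (u n) \<le> M"
    and avg: "\<And>\<phi> :: 'a \<Rightarrow> real. bounded_linear \<phi> \<Longrightarrow> cesaro_null (\<lambda>n. (\<phi> (u n))\<^sup>2)"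
  obtains r where "strict_mono r" "\<And>k. 0 < r k" "has_density r 1"
    "\<And>\<phi> :: 'a \<Rightarrow> real. bounded_linear \<phi> \<Longrightarrow> (\<lambda>k. \<phi> (u (r k))) \<longlonglongrightarrow> 0"
proof -
  have functional_tendsto: "(\<lambda>k. \<phi> (w k)) \<longlonglongrightarrow> 0"
    if \<phi>: "bounded_linear \<phi>" and M: "\<And>k. norm (w k) \<le> M"
      and lim: "\<And>l. (\<lambda>k. w k \<bullet> w l) \<longlonglongrightarrow> 0"
    for w :: "nat \<Rightarrow> 'a" and \<phi> :: "'a \<Rightarrow> real" and M
  proof (rule ccontr)
    assume "\<not> (\<lambda>k. \<phi> (w k)) \<longlonglongrightarrow> 0"
    then obtain e where e: "0 < e" and freq: "\<And>N. \<exists>k\<ge>N. e \<le> \<bar>\<phi> (w k)\<bar>"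
      unfolding LIMSEQ_iff by (auto simp: not_less)
    obtain K where K: "\<And>x. \<bar>\<phi> x\<bar> \<le> K * norm x" "0 < K"
      using bounded_linear.pos_bounded[OF \<phi>] by (auto simp: mult.commute)
    have M0: "0 \<le> M" using M[of 0] norm_ge_zero[of "w 0"] by linarith
    have select: "\<exists>F. finite F \<and> card F = n \<and> (\<forall>i\<in>F. e \<le> \<bar>\<phi> (w i)\<bar>) \<and>
        (\<forall>i\<in>F. \<forall>j\<in>F. i \<noteq> j \<longrightarrow> \<bar>w i \<bullet> w j\<bar> \<le> d)" if d: "0 < d" for n d
    proof (induction n)
      case 0
      show ?case by (intro exI[of _ "{}"]) simp
    next
      case (Suc n)
      then obtain F where F: "finite F" "card F = n" "\<forall>i\<in>F. e \<le> \<bar>\<phi> (w i)\<bar>"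
        "\<forall>i\<in>F. \<forall>j\<in>F. i \<noteq> j \<longrightarrow> \<bar>w i \<bullet> w j\<bar> \<le> d" by blast
      have "\<forall>\<^sub>F k in sequentially. \<bar>w k \<bullet> w l\<bar> < d" for l
        using order_tendstoD(2)[OF tendsto_rabs_zero[OF lim] d] .
      then have "\<forall>\<^sub>F k in sequentially. \<forall>l\<in>F. \<bar>w k \<bullet> w l\<bar> < d"
        using F(1) by (simp add: eventually_ball_finite)
      \<comment> \<open>Choosing the next index above all of \<open>F\<close> ensures that it is
        new.\<close>
      moreover have "\<forall>\<^sub>F k in sequentially. \<forall>l\<in>F. l < k"
        using F(1) by (simp add: eventually_ball_finite eventually_gt_at_top)
      ultimately have "\<forall>\<^sub>F k in sequentially. \<forall>l\<in>F. \<bar>w k \<bullet> w l\<bar> < d \<and> l < k"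
        by eventually_elim blast
      then obtain N where N: "\<And>k l. k \<ge> N \<Longrightarrow> l \<in> F \<Longrightarrow> \<bar>w k \<bullet> w l\<bar> < d \<and> l < k"
        by (auto simp: eventually_sequentially)
      obtain k where k: "k \<ge> N" "e \<le> \<bar>\<phi> (w k)\<bar>" using freq by blast
      have "k \<notin> F" using N[OF k(1), of k] by blast
      then show ?case
        using F k N[OF k(1)]
        by (intro exI[of _ "insert k F"]) (auto simp: inner_commute less_imp_le)
    qed
    define A where "A = K\<^sup>2 * (K * M)\<^sup>2"
    have A: "0 \<le> A" by (simp add: A_def)
    \<comment> \<open>The off-diagonal terms then account for at most half of the lower bound
      \<open>n\<^sup>2 * e ^ 4\<close>; the diagonal grows only linearly in \<open>n\<close>, so the
      \<open>n\<close> chosen next yields a contradiction.\<close>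
    define d where "d = e ^ 4 / (2 * (A + 1))"
    have d: "0 < d" "A * d \<le> e ^ 4 / 2"
    proof -
      show "0 < d" using e A by (simp add: d_def)
      have "A * e ^ 4 \<le> (A + 1) * e ^ 4" using e by (simp add: distrib_right)
      then show "A * d \<le> e ^ 4 / 2" using A by (simp add: d_def field_simps)
    qed
    obtain n :: nat where n: "2 * A * M\<^sup>2 / e ^ 4 < real n" using reals_Archimedean2 by blast
    moreover have "0 \<le> 2 * A * M\<^sup>2 / e ^ 4" using A e by simp
    ultimately have n0: "0 < real n" by linarith
    obtain F where F: "finite F" "card F = n" "\<forall>i\<in>F. e \<le> \<bar>\<phi> (w i)\<bar>"
        "\<forall>i\<in>F. \<forall>j\<in>F. i \<noteq> j \<longrightarrow> \<bar>w i \<bullet> w j\<bar> \<le> d" using select[OF d(1), of n] by (elim exE conjE)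
    have "real n * e\<^sup>2 = (\<Sum>i\<in>F. e\<^sup>2)" using F by simp
    also have "\<dots> \<le> (\<Sum>i\<in>F. (\<phi> (w i))\<^sup>2)"
    proof (rule sum_mono)
      fix i assume "i \<in> F"
      with F(3) have "e \<le> \<bar>\<phi> (w i)\<bar>" by blast
      with e have "e\<^sup>2 \<le> \<bar>\<phi> (w i)\<bar>\<^sup>2" by (intro power_mono) auto
      then show "e\<^sup>2 \<le> (\<phi> (w i))\<^sup>2" by simp
    qed
    finally have "(real n * e\<^sup>2)\<^sup>2 \<le> (\<Sum>i\<in>F. (\<phi> (w i))\<^sup>2)\<^sup>2"
      by (rule power_mono) simp
    also have "\<dots> \<le> A * (\<Sum>i\<in>F. \<Sum>j\<in>F. \<bar>w i \<bullet> w j\<bar>)"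
      unfolding A_def using K by (intro square_sum_functional_le M bounded_linear.linear[OF \<phi>]) auto
    also have "\<dots> \<le> A * (\<Sum>i\<in>F. \<Sum>j\<in>F. (if j = i then M\<^sup>2 else 0) + d)"
    proof (intro mult_left_mono sum_mono A)
      fix i j assume "i \<in> F" "j \<in> F"
      have "w i \<bullet> w i \<le> M\<^sup>2"
        using power_mono[OF M[of i], of 2] by (simp add: power2_norm_eq_inner)
      then show "\<bar>w i \<bullet> w j\<bar> \<le> (if j = i then M\<^sup>2 else 0) + d"
        using F(4) d \<open>i \<in> F\<close> \<open>j \<in> F\<close> by auto
    qed
    also have "\<dots> = A * (real n * M\<^sup>2 + (real n)\<^sup>2 * d)"
      using F(1,2) by (simp add: sum.distrib power2_eq_square distrib_left)
    also have "\<dots> = real n * (A * M\<^sup>2) + (real n)\<^sup>2 * (A * d)"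
      by (simp add: algebra_simps)
    also have "\<dots> \<le> real n * (A * M\<^sup>2) + (real n)\<^sup>2 * (e ^ 4 / 2)"
      using d(2) by (intro add_left_mono mult_left_mono) auto
    finally have "real n * (real n * e ^ 4) \<le> real n * (2 * (A * M\<^sup>2))"
      by (simp add: power_mult_distrib power2_eq_square power4_eq_xxxx algebra_simps)
    then have "real n * e ^ 4 \<le> 2 * (A * M\<^sup>2)"
      using n0 by simp
    with n e show False by (simp add: field_simps)
  qed
  define f where "f i n = (1 / 2) ^ i * \<bar>u n \<bullet> u i\<bar>" for i n
  have f_nonneg: "0 \<le> f i n" for i n by (simp add: f_def)
  have f_le: "f i n \<le> M\<^sup>2 * (1 / 2) ^ i" for i n
  proof -
    have "\<bar>u n \<bullet> u i\<bar> \<le> norm (u n) * norm (u i)" by (rule Cauchy_Schwarz_ineq2)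
    also have "\<dots> \<le> M * M" using M order_trans[OF norm_ge_zero M] by (intro mult_mono) auto
    finally show ?thesis by (simp add: f_def power2_eq_square mult_right_mono mult.commute)
  qed
  have geom: "summable (\<lambda>i. M\<^sup>2 * (1 / 2 :: real) ^ i)"
    by (intro summable_mult summable_geometric) simp
  have summ: "summable (\<lambda>i. f i n)" for n
    by (rule summable_comparison_test[OF _ geom]) (use f_le f_nonneg in auto)
  define F where "F n = (\<Sum>i. f i n)" for n
  have f_null: "cesaro_null (f i)" for i
  proof -
    have "cesaro_null (\<lambda>n. (u n \<bullet> u i)\<^sup>2)"
      by (rule avg) (rule bounded_linear_inner_left)
    from cesaro_null_cmult[OF cesaro_null_of_square[OF this], of "(1 / 2) ^ i"] show ?thesis
      by (simp add: f_def[abs_def])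
  qed
  have F_nonneg: "0 \<le> F n" for n
    unfolding F_def using summ f_nonneg by (rule suminf_nonneg)
  have "cesaro_null F"
  proof (rule cesaro_null_approx[OF F_nonneg])
    fix e :: real assume e: "0 < e"
    \<comment> \<open>\<open>M\<^sup>2 * 2 * (1 / 2) ^ I\<close> bounds the tail of the weighted
      series from \<open>I\<close> on, uniformly in \<open>n\<close>.\<close>
    have "(\<lambda>I. M\<^sup>2 * 2 * (1 / 2 :: real) ^ I) \<longlonglongrightarrow> M\<^sup>2 * 2 * 0"
      by (intro tendsto_intros LIMSEQ_realpow_zero) auto
    then have "\<forall>\<^sub>F I in sequentially. M\<^sup>2 * 2 * (1 / 2 :: real) ^ I < e"
      using e by (simp add: order_tendstoD(2))
    then obtain I where I: "M\<^sup>2 * 2 * (1 / 2 :: real) ^ I < e"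
      by (auto simp: eventually_sequentially)
    have "F n \<le> (\<Sum>i<I. f i n) + e" for n
    proof -
      have "F n = (\<Sum>i. f (i + I) n) + (\<Sum>i<I. f i n)"
        unfolding F_def by (rule suminf_split_initial_segment[OF summ])
      also have "(\<Sum>i. f (i + I) n) \<le> (\<Sum>i. M\<^sup>2 * (1 / 2) ^ (i + I))"
        by (rule suminf_le[OF f_le summable_ignore_initial_segment[OF summ]
              summable_ignore_initial_segment[OF geom]])
      also have "\<dots> = M\<^sup>2 * (1 / 2) ^ I * (\<Sum>i. (1 / 2) ^ i)"
        by (subst suminf_mult[symmetric]) (auto simp: power_add mult_ac intro: summable_geometric)
      also have "\<dots> = M\<^sup>2 * 2 * (1 / 2) ^ I"
        by (simp add: suminf_geometric)
      finally show ?thesis using I by linarith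
    qed
    then show "\<exists>g. cesaro_null g \<and> (\<forall>\<^sub>F n in sequentially. F n \<le> g n + e)"
      using cesaro_null_sum[of "{..<I}" f] f_null by (intro exI[of _ "\<lambda>n. \<Sum>i<I. f i n"]) simp
  qed
  then obtain r where r: "strict_mono r" "\<And>k. 0 < r k" "has_density r 1" "(\<lambda>k. F (r k)) \<longlonglongrightarrow> 0"
    using cesaro_null_imp_density_one F_nonneg by blast
  show ?thesis
  proof (rule that[OF r(1-3)])
    fix \<phi> :: "'a \<Rightarrow> real" assume "bounded_linear \<phi>"
    then show "(\<lambda>k. \<phi> (u (r k))) \<longlonglongrightarrow> 0"
    proof (rule functional_tendsto[where w = "\<lambda>k. u (r k)"])
      fix l
      \<comment> \<open>The inner product with a fixed member is a single term of the series
        \<open>F\<close>, up to the constant weight.\<close>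
      have "norm (u (r k) \<bullet> u (r l)) \<le> 2 ^ r l * F (r k)" for k
      proof -
        have "f (r l) (r k) \<le> F (r k)"
          unfolding F_def using sum_le_suminf[OF summ, of "{r l}"] f_nonneg by simp
        then have "2 ^ r l * f (r l) (r k) \<le> 2 ^ r l * F (r k)" by simp
        then show ?thesis by (simp add: f_def power_divide)
      qed
      then have "\<forall>\<^sub>F k in sequentially. norm (u (r k) \<bullet> u (r l)) \<le> 2 ^ r l * F (r k)" by simp
      moreover have "(\<lambda>k. 2 ^ r l * F (r k)) \<longlonglongrightarrow> 0"
        using tendsto_mult_right[OF r(4), of "2 ^ r l"] by (simp add: mult.commute)
      ultimately show "(\<lambda>k. u (r k) \<bullet> u (r l)) \<longlonglongrightarrow> 0"
        by (rule Lim_null_comparison)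
    qed (rule M)
  qed
qed

section \<open>Differences of integer polynomials\<close>

text \<open>Horner's scheme turns the shifted polynomial into \<open>a\<close> plus
  \<open>X + k\<close> times the shift of the tail. Bounding the degree instead of prescribing it
  lets the induction pass to that tail.\<close>

lemma coeff_shift_poly:
  fixes p :: "int poly"
  assumes "degree p \<le> Suc n"
  shows "coeff (p \<circ>\<^sub>p [:k, 1:]) n = coeff p n + int (Suc n) * k * coeff p (Suc n)"
    and "coeff (p \<circ>\<^sub>p [:k, 1:]) (Suc n) = coeff p (Suc n)"
proof -
  have "degree p \<le> Suc n \<longrightarrow>
    coeff (p \<circ>\<^sub>p [:k, 1:]) n = coeff p n + int (Suc n) * k * coeff p (Suc n) \<and>
    coeff (p \<circ>\<^sub>p [:k, 1:]) (Suc n) = coeff p (Suc n)"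
  proof (induction p arbitrary: n)
    case (pCons a p)
    have step: "coeff (pCons a p \<circ>\<^sub>p [:k, 1:]) m =
        (if m = 0 then a else coeff (p \<circ>\<^sub>p [:k, 1:]) (m - 1)) + k * coeff (p \<circ>\<^sub>p [:k, 1:]) m" for m
      by (cases m) (auto simp: pcompose_pCons)
    show ?case
    proof
      assume deg: "degree (pCons a p) \<le> Suc n"
      then have p: "degree p \<le> n" by (auto split: if_splits)
      then have high: "coeff p (Suc n) = 0" "coeff (p \<circ>\<^sub>p [:k, 1:]) (Suc n) = 0"
        by (auto intro!: coeff_eq_0 simp: degree_pcompose)
      show "coeff (pCons a p \<circ>\<^sub>p [:k, 1:]) n =
          coeff (pCons a p) n + int (Suc n) * k * coeff (pCons a p) (Suc n) \<and>
        coeff (pCons a p \<circ>\<^sub>p [:k, 1:]) (Suc n) = coeff (pCons a p) (Suc n)"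
      proof (cases n)
        case 0
        with p obtain c where "p = [:c:]" by (metis degree_eq_zeroE le_zero_eq)
        with 0 show ?thesis by (simp add: pcompose_pCons)
      next
        case (Suc m)
        with pCons.IH[of m] p high show ?thesis
          unfolding step by (simp add: algebra_simps)
      qed
    qed
  qed simp
  with assms show "coeff (p \<circ>\<^sub>p [:k, 1:]) n = coeff p n + int (Suc n) * k * coeff p (Suc n)"
    and "coeff (p \<circ>\<^sub>p [:k, 1:]) (Suc n) = coeff p (Suc n)" by auto
qed

text \<open>The leading terms cancel, and the next coefficient of the difference is
  \<open>(d + 1) * k\<close> times the leading coefficient of \<open>p\<close>.\<close>

lemma degree_difference_poly:
  fixes p :: "int poly"
  assumes p: "degree p = Suc d" "0 < lead_coeff p" and k: "0 < k"
  defines "q \<equiv> p \<circ>\<^sub>p [:k, 1:] - p"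
  shows "degree q = d" "0 < lead_coeff q"
proof -
  have coeff_d: "coeff q d = int (Suc d) * k * coeff p (Suc d)"
    using coeff_shift_poly(1)[of p d k] p by (simp add: q_def)
  then have pos: "0 < coeff q d" using p k by simp
  have "coeff q i = 0" if "d < i" for i
  proof (cases "i = Suc d")
    case True
    then show ?thesis using coeff_shift_poly(2)[of p d k] p by (simp add: q_def)
  next
    case False
    with that p show ?thesis
      by (simp add: q_def coeff_eq_0 degree_pcompose)
  qed
  then have "degree q \<le> d" by (intro degree_le) auto
  moreover have "d \<le> degree q" using pos by (intro le_degree) auto
  ultimately show "degree q = d" by simp
  with pos show "0 < lead_coeff q" by simp
qed

lemma filterlim_poly_int_at_top:
  fixes p :: "int poly"
  assumes "0 < degree p" "0 < lead_coeff p"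
  shows "filterlim (\<lambda>n. poly p (int n)) at_top sequentially"
  using assms
proof (induction p)
  case (pCons a p)
  have lc: "0 < lead_coeff p" and "p \<noteq> 0" using pCons.prems by (auto split: if_splits)
  have "\<forall>\<^sub>F n in sequentially. 1 \<le> poly p (int n)"
  proof (cases "degree p = 0")
    case True
    then obtain c where "p = [:c:]" by (rule degree_eq_zeroE)
    with lc show ?thesis by simp
  next
    case False
    with pCons.IH lc show ?thesis by (simp add: filterlim_at_top)
  qed
  then have "\<forall>\<^sub>F n in sequentially. int n + a \<le> poly (pCons a p) (int n)"
  proof eventually_elim
    case (elim n)
    then have "int n * 1 \<le> int n * poly p (int n)" by (intro mult_left_mono) auto
    then show ?case by simp
  qed
  moreover have "filterlim (\<lambda>n. int n + a) at_top sequentially"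
    unfolding filterlim_at_top
  proof
    fix Z
    show "\<forall>\<^sub>F n in sequentially. Z \<le> int n + a"
      using eventually_ge_at_top[of "nat (Z - a)"] by eventually_elim linarith
  qed
  ultimately show ?case by (rule filterlim_at_top_mono[rotated])
qed simp

text \<open>The differences \<open>p(j + k) - p(j)\<close> can be negative for small
  \<open>j\<close>. A positive leading coefficient, in contrast, is inherited by them, so it serves
  as the induction hypothesis on polynomials.\<close>

lemma lead_coeff_pos_of_nonneg_int_polys:
  assumes "p \<in> nonneg_int_polys" "0 < degree p"
  shows "0 < lead_coeff p"
proof (rule ccontr)
  assume "\<not> 0 < lead_coeff p"
  moreover have "lead_coeff p \<noteq> 0" using assms(2) by auto
  ultimately have "lead_coeff p < 0" by linarith
  then have "filterlim (\<lambda>n. poly (- p) (int n)) at_top sequentially"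
    using assms(2) by (intro filterlim_poly_int_at_top) auto
  then have "\<forall>\<^sub>F n in sequentially. 1 \<le> poly (- p) (int n)"
    unfolding filterlim_at_top by (rule spec)
  then have "\<forall>\<^sub>F n in sequentially. False"
    using eventually_gt_at_top[of 0]
  proof eventually_elim
    case (elim n)
    moreover have "0 \<le> poly p (int n)" using assms(1) elim by (simp add: nonneg_int_polys_def)
    ultimately show ?case by simp
  qed
  then show False by simp
qed

section \<open>Polynomial orbits of contractions\<close>

text \<open>Cauchy-Schwarz for a semidefinite form, given only through its values along the line
  \<open>x + s y\<close>. For \<open>X > 0\<close> the parameters \<open>s = X / e\<close> and
  \<open>s = - X / e\<close> suffice.\<close>

lemma semidefinite_form_le:
  assumes B: "\<And>s. 0 \<le> Bxx + 2 * s * Bxy + s\<^sup>2 * Byy"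
    and le: "Bxx \<le> X\<^sup>2" "Byy \<le> e\<^sup>2" and pos: "0 \<le> X" "0 < (e::real)"
  shows "\<bar>Bxy\<bar> \<le> e * X"
proof (cases "X = 0")
  case True
  show ?thesis
  proof (rule ccontr)
    assume "\<not> ?thesis"
    then have ne: "Bxy \<noteq> 0" using True by auto
    \<comment> \<open>The minimiser of \<open>2 * s * Bxy + s\<^sup>2 * e\<^sup>2\<close>.\<close>
    define s where "s = - Bxy / e\<^sup>2"
    have "0 \<le> 2 * s * Bxy + s\<^sup>2 * e\<^sup>2"
      using B[of s] le True mult_left_mono[OF le(2), of "s\<^sup>2"] by simp
    also have "\<dots> = - (Bxy\<^sup>2 / e\<^sup>2)"
      using pos by (simp add: s_def field_simps power2_eq_square)
    finally have "Bxy\<^sup>2 / e\<^sup>2 \<le> 0" by simp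
    moreover have "0 < Bxy\<^sup>2 / e\<^sup>2" using ne pos by simp
    ultimately show False by linarith
  qed
next
  case False
  then have X: "0 < X" using pos by simp
  have *: "0 \<le> 2 * X\<^sup>2 + 2 * (s * Bxy)" if "s\<^sup>2 * e\<^sup>2 = X\<^sup>2" for s
    using B[of s] le(1) mult_left_mono[OF le(2), of "s\<^sup>2"] that by simp
  have "\<bar>Bxy\<bar> * X \<le> (e * X) * X"
    using *[of "X / e"] *[of "- X / e"] pos(2)
    by (simp add: power_divide field_simps power2_eq_square abs_if)
  then show ?thesis using X by simp
qed

lemma funpow_linear: "linear (T :: 'a::real_vector \<Rightarrow> 'a) \<Longrightarrow> linear (T ^^ n)"
  by (induction n) (simp_all add: linear_id linear_compose)

lemma norm_funpow_le:
  fixes T :: "'a::real_normed_vector \<Rightarrow> 'a"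
  assumes "\<And>x. norm (T x) \<le> norm x"
  shows "norm ((T ^^ n) x) \<le> norm x"
  by (induction n) (auto intro: order_trans[OF assms])

lemma norm_funpow_antimono:
  fixes T :: "'a::real_normed_vector \<Rightarrow> 'a"
  assumes "\<And>x. norm (T x) \<le> norm x" "m \<le> n"
  shows "norm ((T ^^ n) x) \<le> norm ((T ^^ m) x)"
proof -
  have "(T ^^ n) x = (T ^^ (n - m)) ((T ^^ m) x)"
    using assms(2) funpow_add[of "n - m" m T] by simp
  then show ?thesis using norm_funpow_le[OF assms(1)] by simp
qed

lemma bounded_linear_funpow:
  fixes T :: "'a::real_normed_vector \<Rightarrow> 'a"
  assumes "linear T" "\<And>x. norm (T x) \<le> norm x"
  shows "bounded_linear (T ^^ n)"
  by (rule bounded_linear_intro[of _ 1])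
     (simp_all add: linear_add linear_scale funpow_linear assms norm_funpow_le)

text \<open>
  The forms \<open>(x, y) \<mapsto> T\<^sup>m x \<bullet> T\<^sup>m y\<close> decrease in \<open>m\<close>, so that by Cauchy-Schwarz for the
  semidefinite differences they converge uniformly in \<open>x\<close> on the unit ball.
\<close>
lemma inner_funpow_almost_constant:
  fixes T :: "'a::real_inner \<Rightarrow> 'a"
  assumes T: "linear T" "\<And>x. norm (T x) \<le> norm x" and e: "0 < e"
  obtains M where "\<And>m x. m \<ge> M \<Longrightarrow>
    \<bar>(T ^^ M) x \<bullet> (T ^^ M) h - (T ^^ m) x \<bullet> (T ^^ m) h\<bar> \<le> e * norm x"
proof -
  define a where "a m = (norm ((T ^^ m) h))\<^sup>2" for m
  have "decseq a"
    unfolding a_def by (intro decseq_def[THEN iffD2] allI impI power_mono norm_funpow_antimono T) auto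
  moreover have "0 \<le> a m" for m by (simp add: a_def)
  ultimately obtain L where "a \<longlonglongrightarrow> L" "\<And>m. L \<le> a m"
    using decseq_convergent[of a 0] by blast
  \<comment> \<open>Beyond \<open>M\<close> the squared norms along the orbit of \<open>h\<close>
    lose less than \<open>e\<^sup>2\<close>. This depends on \<open>h\<close> alone, which makes
    \<open>M\<close> uniform in \<open>x\<close>.\<close>
  then obtain M where M: "a M < L + e\<^sup>2"
    using order_tendstoD(2)[of a L sequentially "L + e\<^sup>2"] e by (auto simp: eventually_sequentially)
  have "\<bar>(T ^^ M) x \<bullet> (T ^^ M) h - (T ^^ m) x \<bullet> (T ^^ m) h\<bar> \<le> e * norm x" if m: "m \<ge> M" for m x
  proof (rule semidefinite_form_le[where Bxx = "(norm ((T ^^ M) x))\<^sup>2 - (norm ((T ^^ m) x))\<^sup>2"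
        and Byy = "a M - a m"])
    fix s
    have add: "(T ^^ k) (x + s *\<^sub>R h) = (T ^^ k) x + s *\<^sub>R (T ^^ k) h" for k
      using funpow_linear[OF T(1), of k] by (simp add: linear_add linear_scale)
    have "(norm ((T ^^ m) (x + s *\<^sub>R h)))\<^sup>2 \<le> (norm ((T ^^ M) (x + s *\<^sub>R h)))\<^sup>2"
      by (intro power_mono norm_funpow_antimono T m) simp
    then show "0 \<le> (norm ((T ^^ M) x))\<^sup>2 - (norm ((T ^^ m) x))\<^sup>2 +
        2 * s * ((T ^^ M) x \<bullet> (T ^^ M) h - (T ^^ m) x \<bullet> (T ^^ m) h) + s\<^sup>2 * (a M - a m)"
      unfolding a_def power2_norm_eq_inner add
      by (simp add: inner_commute algebra_simps power2_eq_square)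
  next
    have "(norm ((T ^^ M) x))\<^sup>2 \<le> (norm x)\<^sup>2" by (intro power_mono norm_funpow_le T) simp
    then show "(norm ((T ^^ M) x))\<^sup>2 - (norm ((T ^^ m) x))\<^sup>2 \<le> (norm x)\<^sup>2"
      using zero_le_power2[of "norm ((T ^^ m) x)"] by linarith
    show "a M - a m \<le> e\<^sup>2" using M \<open>\<And>m. L \<le> a m\<close>[of m] by linarith
  qed (use e in auto)
  then show ?thesis by (rule that)
qed

text \<open>The induction must vary \<open>\<phi>\<close>: the correlations of degree
  \<open>d + 1\<close> are compared with a new functional along an orbit of degree \<open>d\<close>.
  Linear polynomials form the base case.\<close>

lemma cesaro_null_poly_orbit:
  fixes T :: "'a::real_inner \<Rightarrow> 'a" and p :: "int poly"
  assumes T: "linear T" "\<And>x. norm (T x) \<le> norm x"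
    and orbit: "\<And>x \<phi>. bounded_linear (\<phi> :: 'a \<Rightarrow> real) \<Longrightarrow> cesaro_null (\<lambda>n. (\<phi> ((T ^^ n) x))\<^sup>2)"
    and "0 < degree p" "0 < lead_coeff p" "bounded_linear (\<phi> :: 'a \<Rightarrow> real)"
  shows "cesaro_null (\<lambda>n. (\<phi> ((T ^^ nat (poly p (int n))) h))\<^sup>2)"
  using assms(4-)
proof (induction "degree p" arbitrary: p h \<phi>)
  case (Suc d p h \<phi>)
  have p_top: "filterlim (\<lambda>n. poly p (int n)) at_top sequentially"
    using Suc.hyps(2) Suc.prems by (intro filterlim_poly_int_at_top) auto
  show ?case
  proof (cases "d = 0")
    case True
    obtain b p' where b: "p = pCons b p'" by (cases p)
    with True have "degree p' = 0" using Suc.hyps(2) by (simp split: if_splits)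
    then obtain a where "p' = [:a:]" by (rule degree_eq_zeroE)
    with b have p: "p = [:b, a:]" by simp
    have a: "0 < a" using Suc.prems p by (auto split: if_splits)
    \<comment> \<open>For early \<open>n\<close> the conversion \<open>nat\<close> may truncate
      negative values, so injectivity holds only from \<open>s\<close> on.\<close>
    obtain s where s: "\<And>n. n \<ge> s \<Longrightarrow> 0 \<le> poly p (int n)"
      using p_top unfolding filterlim_at_top eventually_sequentially by metis
    have inj: "inj_on (\<lambda>n. nat (poly p (int n))) {s..}"
    proof (rule inj_onI)
      fix m n assume "m \<in> {s..}" "n \<in> {s..}" "nat (poly p (int m)) = nat (poly p (int n))"
      then have "poly p (int m) = poly p (int n)" using s[of m] s[of n] by auto
      then show "m = n" using a by (simp add: p)
    qed
    have "nat (poly p (int n)) \<le> nat a * n + nat \<bar>b\<bar>" for n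
    proof -
      have "poly p (int n) \<le> int (nat a * n + nat \<bar>b\<bar>)" using a by (simp add: p algebra_simps)
      then show ?thesis by linarith
    qed
    then show ?thesis
      by (intro cesaro_null_reindex[OF orbit[OF Suc.prems(3)] _ inj]) simp_all
  next
    case False
    show ?thesis
    proof (rule cesaro_null_functional_of_correlations[OF Suc.prems(3) norm_funpow_le[OF T(2)]])
      fix k :: nat assume k: "0 < k"
      define q where "q = p \<circ>\<^sub>p [:int k, 1:] - p"
      have q: "degree q = d" "0 < lead_coeff q"
        using degree_difference_poly[of p d "int k"] Suc.hyps(2) Suc.prems(2) k by (auto simp: q_def)
      have q_top: "filterlim (\<lambda>n. poly q (int n)) at_top sequentially"
        using q False by (intro filterlim_poly_int_at_top) auto
      show "cesaro_null (\<lambda>n. \<bar>(T ^^ nat (poly p (int (n + k)))) h \<bullet> (T ^^ nat (poly p (int n))) h\<bar>)"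
      proof (rule cesaro_null_approx)
        fix e :: real assume e: "0 < e"
        \<comment> \<open>Scaled so that \<open>e' * norm h \<le> e\<close>; the added
          \<open>1\<close> covers \<open>h = 0\<close>.\<close>
        define e' where "e' = e / (norm h + 1)"
        have pos: "0 < norm h + 1" using norm_ge_zero[of h] by linarith
        then have e': "0 < e'" using e by (simp add: e'_def)
        have "e' * norm h \<le> e' * (norm h + 1)" using e' by simp
        also have "\<dots> = e" using pos by (simp add: e'_def)
        finally have e'_le: "e' * norm h \<le> e" .
        obtain M where M: "\<And>m x. m \<ge> M \<Longrightarrow>
            \<bar>(T ^^ M) x \<bullet> (T ^^ M) h - (T ^^ m) x \<bullet> (T ^^ m) h\<bar> \<le> e' * norm x"
          using inner_funpow_almost_constant[OF T e'] by blast
        \<comment> \<open>The correlation form frozen at the exponent \<open>M\<close>, as a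
          functional of its first argument.\<close>
        define \<psi> where "\<psi> x = (T ^^ M) x \<bullet> (T ^^ M) h" for x
        have "bounded_linear \<psi>"
          unfolding \<psi>_def by (intro bounded_linear_inner_left_comp bounded_linear_funpow T)
        then have "cesaro_null (\<lambda>n. (\<psi> ((T ^^ nat (poly q (int n))) h))\<^sup>2)"
          using q False by (intro Suc.hyps(1)) auto
        then have "cesaro_null (\<lambda>n. \<bar>\<psi> ((T ^^ nat (poly q (int n))) h)\<bar>)"
          by (rule cesaro_null_of_square)
        moreover have "\<forall>\<^sub>F n in sequentially.
            \<bar>(T ^^ nat (poly p (int (n + k)))) h \<bullet> (T ^^ nat (poly p (int n))) h\<bar>
              \<le> \<bar>\<psi> ((T ^^ nat (poly q (int n))) h)\<bar> + e"
        proof -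
          \<comment> \<open>Eventually \<open>nat\<close> truncates neither exponent, and
            \<open>p(n)\<close> lies in the range where freezing at \<open>M\<close> is
            accurate.\<close>
          have "\<forall>\<^sub>F n in sequentially. int M \<le> poly p (int n)" "\<forall>\<^sub>F n in sequentially. 0 \<le> poly q (int n)"
            using p_top q_top by (auto simp: filterlim_at_top)
          then show ?thesis
          proof eventually_elim
            case (elim n)
            define m where "m = nat (poly p (int n))"
            define x where "x = (T ^^ nat (poly q (int n))) h"
            have "poly p (int (n + k)) = poly p (int n) + poly q (int n)"
              by (simp add: q_def poly_pcompose add.commute)
            then have "nat (poly p (int (n + k))) = m + nat (poly q (int n))"
              using elim by (simp add: m_def nat_add_distrib)
            then have shift: "(T ^^ nat (poly p (int (n + k)))) h = (T ^^ m) x"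
              by (simp add: x_def funpow_add)
            have "\<bar>\<psi> x - (T ^^ m) x \<bullet> (T ^^ m) h\<bar> \<le> e' * norm x"
              unfolding \<psi>_def by (rule M) (use elim in \<open>simp add: m_def le_nat_iff\<close>)
            moreover have "e' * norm x \<le> e' * norm h"
              unfolding x_def using e' by (intro mult_left_mono norm_funpow_le T) simp
            ultimately show ?case 
              unfolding shift unfolding x_def[symmetric] m_def[symmetric] using e'_le by linarith
          qed
        qed
        ultimately show "\<exists>g. cesaro_null g \<and> (\<forall>\<^sub>F n in sequentially.
            \<bar>(T ^^ nat (poly p (int (n + k)))) h \<bullet> (T ^^ nat (poly p (int n))) h\<bar> \<le> g n + e)"
          by (intro exI conjI)
      qed simp
    qed
  qed
qed simp

lemma bounded_functional_scaleR_iff: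
  "bounded_functional scaleR (\<phi> :: 'a::real_normed_vector \<Rightarrow> real) \<longleftrightarrow> bounded_linear \<phi>"
  by (auto simp: bounded_functional_def linear_def real_scaleR_def[abs_def] dest: bounded_linear.linear)

text \<open>Only real linearity of \<open>T\<close> is assumed, so that the lemma also applies to a
  complex operator on the underlying real space.\<close>

lemma almost_weakly_polynomial_stable_of_real:
  fixes T :: "'a::real_inner \<Rightarrow> 'a"
  assumes T: "bounded_linear T" "onorm T \<le> 1"
    and stable: "\<And>x. almost_weakly_stable_seq scaleR (\<lambda>n. (T ^^ n) x)"
  shows "almost_weakly_polynomial_stable scaleR T"
proof -
  have norm_T: "norm (T x) \<le> norm x" for x
    using onorm[OF T(1), of x] mult_right_mono[OF T(2), of "norm x"] by simp
  have orbit: "cesaro_null (\<lambda>n. (\<phi> ((T ^^ n) x))\<^sup>2)" if \<phi>: "bounded_linear \<phi>" for \<phi> :: "'a \<Rightarrow> real" and x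
  proof -
    obtain r where r: "strict_mono r" "has_density r 1" "weakly_tendsto scaleR (\<lambda>k. (T ^^ r k) x) 0"
      using stable[of x] unfolding almost_weakly_stable_seq_def by (elim exE conjE)
    have "(\<lambda>k. \<phi> ((T ^^ r k) x)) \<longlonglongrightarrow> \<phi> 0"
      using r(3) \<phi> unfolding weakly_tendsto_def bounded_functional_scaleR_iff by blast
    from tendsto_power[OF this, of 2]
    have lim: "(\<lambda>k. (\<phi> ((T ^^ r k) x))\<^sup>2) \<longlonglongrightarrow> 0"
      using linear_0[OF bounded_linear.linear[OF \<phi>]] by simp
    obtain K where K: "\<And>x. \<bar>\<phi> x\<bar> \<le> K * norm x" "0 < K"
      using bounded_linear.pos_bounded[OF \<phi>] by (auto simp: mult.commute)
    show ?thesis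
    proof (rule cesaro_null_of_density_one[OF r(1,2) lim])
      fix n
      have "\<bar>\<phi> ((T ^^ n) x)\<bar> \<le> K * norm x"
        using K(1)[of "(T ^^ n) x"] mult_left_mono[OF norm_funpow_le[of T n x, OF norm_T], of K] K(2) by linarith
      then have "\<bar>\<phi> ((T ^^ n) x)\<bar>\<^sup>2 \<le> (K * norm x)\<^sup>2" by (rule power_mono) simp
      then show "(\<phi> ((T ^^ n) x))\<^sup>2 \<le> (K * norm x)\<^sup>2" by simp
    qed simp
  qed
  show ?thesis
    unfolding almost_weakly_polynomial_stable_def
  proof (intro allI ballI impI)
    fix h and p :: "int poly" assume p: "p \<in> nonneg_int_polys" "0 < degree p"
    have avg: "cesaro_null (\<lambda>n. (\<phi> ((T ^^ nat (poly p (int n))) h))\<^sup>2)" if "bounded_linear \<phi>"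
      for \<phi> :: "'a \<Rightarrow> real"
      by (rule cesaro_null_poly_orbit[OF bounded_linear.linear[OF T(1)] norm_T orbit p(2) lead_coeff_pos_of_nonneg_int_polys[OF p] that])
    obtain r where "strict_mono r" "\<And>k. 0 < r k" "has_density r 1"
      and r: "\<And>\<phi> :: 'a \<Rightarrow> real. bounded_linear \<phi> \<Longrightarrow>
        (\<lambda>k. \<phi> ((T ^^ nat (poly p (int (r k)))) h)) \<longlonglongrightarrow> 0"
      using density_one_of_cesaro_null[of "\<lambda>n. (T ^^ nat (poly p (int n))) h",
        OF norm_funpow_le[OF norm_T] avg] by blast
    then show "almost_weakly_stable_seq scaleR (\<lambda>j. (T ^^ nat (poly p (int j))) h)"
      unfolding almost_weakly_stable_seq_def weakly_tendsto_def bounded_functional_scaleR_iff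
      by (auto simp: linear_0 bounded_linear.linear intro!: exI[of _ r])
  qed
qed

section \<open>Complex spaces as real spaces\<close>

lemma cinner_scaleC_right: "cinner x (a *\<^sub>C y) = cnj a * cinner x y"
proof -
  have "cinner x (a *\<^sub>C y) = cnj (cinner (a *\<^sub>C y) x)" by (rule cinner_commute)
  also have "\<dots> = cnj a * cinner x y" by (simp add: cinner_scaleC_left cinner_commute[of x y])
  finally show ?thesis .
qed

lemma bounded_linear_scaleC_ii: "bounded_linear (\<lambda>x :: 'a::complex_inner. \<i> *\<^sub>C x)"
proof (rule bounded_linear_intro[of _ 1])
  show "\<i> *\<^sub>C (r *\<^sub>R x) = r *\<^sub>R \<i> *\<^sub>C x" for r and x :: 'a
    by (simp only: scaleC_of_real[symmetric] scaleC_scaleC mult.commute)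
  show "norm (\<i> *\<^sub>C x) \<le> norm x * 1" for x :: 'a
    by (simp add: norm_eq_sqrt_cinner cinner_scaleC_left cinner_scaleC_right)
qed (simp add: scaleC_add_right)

text \<open>The functional \<open>\<phi>(x) - i \<phi>(i x)\<close> has real part
  \<open>\<phi>\<close>; every bounded real functional thus extends to a complex one.\<close>

lemma bounded_functional_complexify:
  fixes \<phi> :: "'a::complex_inner \<Rightarrow> real"
  assumes "bounded_linear \<phi>"
  shows "bounded_functional scaleC (\<lambda>x. Complex (\<phi> x) (- \<phi> (\<i> *\<^sub>C x)))"
proof -
  note \<phi> = bounded_linear.linear[OF assms]
  note I = bounded_linear.linear[OF bounded_linear_scaleC_ii]
  have scaleC_eq: "a *\<^sub>C x = Re a *\<^sub>R x + Im a *\<^sub>R \<i> *\<^sub>C x" for a and x :: 'a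
  proof -
    have "a = complex_of_real (Re a) + complex_of_real (Im a) * \<i>"
      by (simp add: complex_eq_iff)
    then have "a *\<^sub>C x = (complex_of_real (Re a) + complex_of_real (Im a) * \<i>) *\<^sub>C x"
      by (rule arg_cong)
    also have "\<dots> = Re a *\<^sub>R x + Im a *\<^sub>R \<i> *\<^sub>C x"
      by (simp only: scaleC_add_left scaleC_scaleC[symmetric] scaleC_of_real)
    finally show ?thesis .
  qed
  have ii: "\<i> *\<^sub>C \<i> *\<^sub>C x = - x" for x :: 'a
    using scaleC_of_real[of "- 1" x] by (simp add: scaleC_scaleC)
  have scale: "Complex (\<phi> (a *\<^sub>C x)) (- \<phi> (\<i> *\<^sub>C a *\<^sub>C x)) = a * Complex (\<phi> x) (- \<phi> (\<i> *\<^sub>C x))" for a x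
    unfolding scaleC_eq[of a x]
    by (simp add: complex_eq_iff linear_add[OF I] linear_scale[OF I] ii linear_add[OF \<phi>]
        linear_diff[OF \<phi>] linear_scale[OF \<phi>] linear_neg[OF \<phi>] algebra_simps)
  have "Vector_Spaces.linear scaleC (*) (\<lambda>x. Complex (\<phi> x) (- \<phi> (\<i> *\<^sub>C x)))"
    unfolding Vector_Spaces.linear_def module_hom_def module_hom_axioms_def
    using vector_space_scaleC[where 'a = 'a] vector_space_over_itself.vector_space_axioms[where 'a = complex]
    by (auto simp: module_iff_vector_space scale complex_eq_iff linear_add[OF \<phi>] linear_add[OF I])
  moreover have "bounded_linear (\<lambda>x. Complex (\<phi> x) (- \<phi> (\<i> *\<^sub>C x)))"
  proof -
    have "bounded_linear (\<lambda>x. of_real (\<phi> x) + \<i> * of_real (- \<phi> (\<i> *\<^sub>C x)))"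
      by (intro bounded_linear_add bounded_linear_compose[OF bounded_linear_of_real] assms
          bounded_linear_compose[OF bounded_linear_mult_right] bounded_linear_minus
          bounded_linear_compose[OF assms] bounded_linear_scaleC_ii)
    then show ?thesis by (simp add: Complex_eq)
  qed
  ultimately show ?thesis by (simp add: bounded_functional_def)
qed

text \<open>Real functionals are real parts of complex ones, and real and imaginary parts of complex
  functionals are real functionals.\<close>

lemma weakly_tendsto_scaleC_iff:
  fixes x :: "nat \<Rightarrow> 'a::complex_inner"
  shows "weakly_tendsto scaleC x l \<longleftrightarrow> weakly_tendsto scaleR x l"
proof
  assume lim: "weakly_tendsto scaleC x l"
  show "weakly_tendsto scaleR x l"
    unfolding weakly_tendsto_def bounded_functional_scaleR_iff
  proof (intro allI impI)
    fix \<phi> :: "'a \<Rightarrow> real" assume "bounded_linear \<phi>"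
    from lim bounded_functional_complexify[OF this] show "(\<lambda>k. \<phi> (x k)) \<longlonglongrightarrow> \<phi> l"
      unfolding weakly_tendsto_def tendsto_complex_iff by fastforce
  qed
next
  assume lim: "weakly_tendsto scaleR x l"
  show "weakly_tendsto scaleC x l"
    unfolding weakly_tendsto_def
  proof (intro allI impI)
    fix \<phi> :: "'a \<Rightarrow> complex" assume "bounded_functional scaleC \<phi>"
    then have "bounded_linear \<phi>" by (simp add: bounded_functional_def)
    then show "(\<lambda>k. \<phi> (x k)) \<longlonglongrightarrow> \<phi> l"
      using lim bounded_linear_compose[OF bounded_linear_Re] bounded_linear_compose[OF bounded_linear_Im]
      unfolding weakly_tendsto_def bounded_functional_scaleR_iff tendsto_complex_iff by blast
  qed
qed

theorem theorem1p1:
  fixes T :: "'a::{real_inner, complete_space} \<Rightarrow> 'a"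
    and S :: "'b::{complex_inner, complete_space} \<Rightarrow> 'b"
  shows "(contraction scaleR T \<and> almost_weakly_stable scaleR T
            \<longrightarrow> almost_weakly_polynomial_stable scaleR T)
       \<and> (contraction scaleC S \<and> almost_weakly_stable scaleC S
            \<longrightarrow> almost_weakly_polynomial_stable scaleC S)"
proof -
  have seq: "almost_weakly_stable_seq scaleC x \<longleftrightarrow> almost_weakly_stable_seq scaleR x" for x :: "nat \<Rightarrow> 'b"
    by (simp add: almost_weakly_stable_seq_def weakly_tendsto_scaleC_iff)
  have "almost_weakly_polynomial_stable scaleR T"
    if "contraction scaleR T" "almost_weakly_stable scaleR T"
    using that by (intro almost_weakly_polynomial_stable_of_real)
      (auto simp: contraction_def bounded_operator_def almost_weakly_stable_def)
  moreover have "almost_weakly_polynomial_stable scaleC S"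
    if "contraction scaleC S" "almost_weakly_stable scaleC S"
  proof -
    \<comment> \<open>Orbits, norms and weak limits of \<open>S\<close> agree over both fields, so
      the real result transfers.\<close>
    have "almost_weakly_polynomial_stable scaleR S"
      using that by (intro almost_weakly_polynomial_stable_of_real)
        (auto simp: contraction_def bounded_operator_def almost_weakly_stable_def seq)
    then show ?thesis by (simp add: almost_weakly_polynomial_stable_def seq)
  qed
  ultimately show ?thesis by blast
qed

end
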